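(* Coins satisfy the decreasing returns property. That is, if for every arm $i$ one has $\mathcal A_i=\{p,\phi_i\}$ and $$r_i(s_i,p)\ \ge\ \sum_{s_i'\in\mathcal S_i}P_i(s_i,p,s_i')\,r_i(s_i',p)\qquad\text{for all } i \text{ and all } s_i\in\mathcal S_i,$$ then $$E[R_i^{m+1}]-E[R_i^{m}]\ \le\ E[R_i^m]-E[R_i^{m-1}]$$ for all $i$ and all integers $0<m<T$.
   Context: **Bandit model.** Integers $n\ge1$, $1\le k\le n$, $T\ge1$. Arm $i\in\{1,\dots,n\}$ is a Markov decision process with finite state space $\mathcal S_i$, finite action space $\mathcal A_i$, reward $r_i:\mathcal S_i\times\mathcal A_i\to\mathbb R_+$ (nonnegative reals) and transition kernel $P_i(s_i,a_i,s_i')$. Each $\mathcal A_i$ contains an idle action $\phi_i$ with $r_i(s_i,\phi_i)=0$ and $P_i(s_i,\phi_i,s_i)=1$ for all $s_i$. Choosing $a_i\ne\phi_i$ is a pull of arm $i$. $\mathcal S=\prod_i\mathcal S_i$; times are $t\in\{0,\dots,T-1\}$. **Relaxed LP.** For a distribution $\tilde\pi_0$ on $\mathcal S$, $RLP(\tilde\pi_0)$ is the linear program in variables $\pi_i(s_i,a_i,t)\ge0$: maximize $\sum_i\sum_t\sum_{s_i,a_i}\pi_i(s_i,a_i,t)r_i(s_i,a_i)$ subject to (i) $\sum_{a_i}\pi_i(s_i,a_i,t)=\sum_{s_i',a_i'}P_i(s_i',a_i',s_i)\pi_i(s_i',a_i',t-1)$ for all $i,s_i,t>0$; (ii) $\sum_i[T-\sum_{s_i}\sum_t\pi_i(s_i,\phi_i,t)]\le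 kT$; (iii) $\sum_{a_i}\pi_i(s_i,a_i,0)=\sum_{\bar s:\bar s_i=s_i}\tilde\pi_0(\bar s)$ for all $i,s_i$. **Relaxed policy $\mu^R$.** $\tilde\pi_0$ puts mass $1$ on a single state $s_0=(s_{0,1},\dots,s_{0,n})$. Given an optimal solution $\bar\pi$ of $RLP(\tilde\pi_0)$, let the arms evolve independently of one another: $s_i^0=s_{0,i}$; at time $t$ the action $\mu_i^R(s_i^t,t)$ equals $a_i$ with probability $\bar\pi_i(s_i^t,a_i,t)/\sum_a\bar\pi_i(s_i^t,a,t)$, independently of the past; then $s_i^{t+1}\sim P_i(s_i^t,\mu_i^R(s_i^t,t),\cdot)$. **Reward from first $m$ pulls.** $L_i(l)=\sum_{t=0}^l\mathbf 1_{\mu_i^R(s_i^t,t)\ne\phi_i}$ and $R_i^m=\sum_{l=0}^{T-1}\mathbf 1_{L_i(l)\le m}\,r_i(s_i^l,\mu_i^R(s_i^l,l))$. The decreasing returns property is the statement that $E[R_i^{m+1}]-E[R_i^m]\le E[R_i^m]-E[R_i^{m-1}]$ for all $i$ and all integers $0<m<T$. *)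

theory Defs
  imports "HOL-Probability.Probability"
begin

text \<open>Arms are indexed by \<open>{1..n}\<close>. Their state and action spaces are finite carrier sets
  inside common types, so they may differ from arm to arm; all data are relevant on the
  carriers only.\<close>

record ('s, 'a) bandit =
  narms :: nat
  budget :: nat
  horizon :: nat
  sts :: "nat \<Rightarrow> 's set"
  acts :: "nat \<Rightarrow> 'a set"
  idle :: "nat \<Rightarrow> 'a"
  rew :: "nat \<Rightarrow> 's \<Rightarrow> 'a \<Rightarrow> real"
  kern :: "nat \<Rightarrow> 's \<Rightarrow> 'a \<Rightarrow> 's pmf"

abbreviation arms :: "('s, 'a) bandit \<Rightarrow> nat set" where
  "arms B \<equiv> {1..narms B}"

definition bandit_model :: "('s, 'a) bandit \<Rightarrow> bool" where
  "bandit_model B \<longleftrightarrow>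
     1 \<le> narms B \<and> 1 \<le> budget B \<and> budget B \<le> narms B \<and> 1 \<le> horizon B \<and>
     (\<forall>i\<in>arms B.
        finite (sts B i) \<and> finite (acts B i) \<and> idle B i \<in> acts B i \<and>
        (\<forall>s\<in>sts B i. \<forall>a\<in>acts B i. 0 \<le> rew B i s a \<and> set_pmf (kern B i s a) \<subseteq> sts B i) \<and>
        (\<forall>s\<in>sts B i. rew B i s (idle B i) = 0 \<and> pmf (kern B i s (idle B i)) s = 1))"

definition joint_sts :: "('s, 'a) bandit \<Rightarrow> (nat \<Rightarrow> 's) set" where
  "joint_sts B = PiE (arms B) (sts B)"

text \<open>A point of the linear program is a family \<open>x i s a t\<close>.\<close>

type_synonym ('s, 'a) rlp_point = "nat \<Rightarrow> 's \<Rightarrow> 'a \<Rightarrow> nat \<Rightarrow> real"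

definition rlp_feasible ::
  "('s, 'a) bandit \<Rightarrow> (nat \<Rightarrow> 's) pmf \<Rightarrow> ('s, 'a) rlp_point \<Rightarrow> bool" where
  "rlp_feasible B \<pi>\<^sub>0 x \<longleftrightarrow>
     (\<forall>i\<in>arms B. \<forall>s\<in>sts B i. \<forall>a\<in>acts B i. \<forall>t<horizon B. 0 \<le> x i s a t) \<and>
     (\<forall>i\<in>arms B. \<forall>s\<in>sts B i. \<forall>t. 0 < t \<and> t < horizon B \<longrightarrow>
        (\<Sum>a\<in>acts B i. x i s a t) =
        (\<Sum>s'\<in>sts B i. \<Sum>a'\<in>acts B i. pmf (kern B i s' a') s * x i s' a' (t - 1))) \<and>
     (\<Sum>i\<in>arms B. real (horizon B) - (\<Sum>s\<in>sts B i. \<Sum>t<horizon B. x i s (idle B i) t))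
       \<le> real (budget B) * real (horizon B) \<and>
     (\<forall>i\<in>arms B. \<forall>s\<in>sts B i.
        (\<Sum>a\<in>acts B i. x i s a 0) = (\<Sum>z\<in>{z\<in>joint_sts B. z i = s}. pmf \<pi>\<^sub>0 z))"

definition rlp_objective :: "('s, 'a) bandit \<Rightarrow> ('s, 'a) rlp_point \<Rightarrow> real" where
  "rlp_objective B x =
     (\<Sum>i\<in>arms B. \<Sum>t<horizon B. \<Sum>s\<in>sts B i. \<Sum>a\<in>acts B i. x i s a t * rew B i s a)"

definition rlp_optimal ::
  "('s, 'a) bandit \<Rightarrow> (nat \<Rightarrow> 's) pmf \<Rightarrow> ('s, 'a) rlp_point \<Rightarrow> bool" where
  "rlp_optimal B \<pi>\<^sub>0 x \<longleftrightarrow> is_arg_max (rlp_objective B) (rlp_feasible B \<pi>\<^sub>0) x"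

text \<open>\<open>\<mu> i s t\<close> is the law of the action taken by arm \<open>i\<close> in state \<open>s\<close> at time \<open>t\<close>. Where the
  normalising sum vanishes, the quotient is meaningless and the law is left arbitrary.\<close>

definition relaxed_policy ::
  "('s, 'a) bandit \<Rightarrow> ('s, 'a) rlp_point \<Rightarrow> (nat \<Rightarrow> 's \<Rightarrow> nat \<Rightarrow> 'a pmf) \<Rightarrow> bool" where
  "relaxed_policy B x \<mu> \<longleftrightarrow>
     (\<forall>i\<in>arms B. \<forall>s\<in>sts B i. \<forall>t<horizon B.
        set_pmf (\<mu> i s t) \<subseteq> acts B i \<and>
        ((\<Sum>b\<in>acts B i. x i s b t) \<noteq> 0 \<longrightarrow>
          (\<forall>a\<in>acts B i. pmf (\<mu> i s t) a = x i s a t / (\<Sum>b\<in>acts B i. x i s b t))))"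

text \<open>Law of the list of the next \<open>d\<close> state-action pairs of arm \<open>i\<close>, started in state \<open>s\<close>
  at time \<open>t\<close>.\<close>

primrec arm_run ::
  "('s, 'a) bandit \<Rightarrow> (nat \<Rightarrow> 's \<Rightarrow> nat \<Rightarrow> 'a pmf) \<Rightarrow> nat \<Rightarrow> nat \<Rightarrow> nat \<Rightarrow> 's \<Rightarrow> ('s \<times> 'a) list pmf"
  where
  "arm_run B \<mu> i 0 t s = return_pmf []"
| "arm_run B \<mu> i (Suc d) t s =
     bind_pmf (\<mu> i s t) (\<lambda>a.
       bind_pmf (kern B i s a) (\<lambda>s'.
         map_pmf (\<lambda>w. (s, a) # w) (arm_run B \<mu> i d (Suc t) s')))"

definition run_law ::
  "('s, 'a) bandit \<Rightarrow> (nat \<Rightarrow> 's \<Rightarrow> nat \<Rightarrow> 'a pmf) \<Rightarrow> (nat \<Rightarrow> 's) \<Rightarrow> (nat \<Rightarrow> ('s \<times> 'a) list) pmf"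
  where
  "run_law B \<mu> s\<^sub>0 = Pi_pmf (arms B) [] (\<lambda>i. arm_run B \<mu> i (horizon B) 0 (s\<^sub>0 i))"

abbreviation st_at :: "(nat \<Rightarrow> ('s \<times> 'a) list) \<Rightarrow> nat \<Rightarrow> nat \<Rightarrow> 's" where
  "st_at \<omega> i t \<equiv> fst (\<omega> i ! t)"

abbreviation act_at :: "(nat \<Rightarrow> ('s \<times> 'a) list) \<Rightarrow> nat \<Rightarrow> nat \<Rightarrow> 'a" where
  "act_at \<omega> i t \<equiv> snd (\<omega> i ! t)"

definition pulls :: "('s, 'a) bandit \<Rightarrow> nat \<Rightarrow> nat \<Rightarrow> (nat \<Rightarrow> ('s \<times> 'a) list) \<Rightarrow> nat" where
  "pulls B i l \<omega> = (\<Sum>t=0..l. of_bool (act_at \<omega> i t \<noteq> idle B i))"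

definition pull_reward :: "('s, 'a) bandit \<Rightarrow> nat \<Rightarrow> nat \<Rightarrow> (nat \<Rightarrow> ('s \<times> 'a) list) \<Rightarrow> real" where
  "pull_reward B i m \<omega> =
     (\<Sum>l<horizon B. of_bool (pulls B i l \<omega> \<le> m) * rew B i (st_at \<omega> i l) (act_at \<omega> i l))"

definition expected_pull_reward ::
  "('s, 'a) bandit \<Rightarrow> (nat \<Rightarrow> 's \<Rightarrow> nat \<Rightarrow> 'a pmf) \<Rightarrow> (nat \<Rightarrow> 's) \<Rightarrow> nat \<Rightarrow> nat \<Rightarrow> real" where
  "expected_pull_reward B \<mu> s\<^sub>0 i m =
     measure_pmf.expectation (run_law B \<mu> s\<^sub>0) (pull_reward B i m)"

definition decreasing_returns ::
  "('s, 'a) bandit \<Rightarrow> (nat \<Rightarrow> 's \<Rightarrow> nat \<Rightarrow> 'a pmf) \<Rightarrow> (nat \<Rightarrow> 's) \<Rightarrow> bool" where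
  "decreasing_returns B \<mu> s\<^sub>0 \<longleftrightarrow>
     (\<forall>i\<in>arms B. \<forall>m. 0 < m \<and> m < horizon B \<longrightarrow>
        expected_pull_reward B \<mu> s\<^sub>0 i (m + 1) - expected_pull_reward B \<mu> s\<^sub>0 i m
        \<le> expected_pull_reward B \<mu> s\<^sub>0 i m - expected_pull_reward B \<mu> s\<^sub>0 i (m - 1))"

end

theory Submission
  imports Defs
begin

text \<open>The marginal value of allowing one more pull, \<open>E R_(m+1) - E R_m\<close>, is the expected
  reward of pull number \<open>m + 1\<close>, counted as \<open>0\<close> when the run ends before that pull. So the claim
  is that a later pull is never worth more, on average, than the one before it.

  An idle arm keeps its state. Hence the state in which pull \<open>j + 1\<close> happens, if it happens, is
  the state that pull \<open>j\<close> led to, however long the arm rests in between. By hypothesis, the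
  reward of pulling in that state is, on average, at most the reward just collected. Whether
  the arm is pulled again may depend on that state, but this selection can only lower the
  average: it replaces some of the nonnegative rewards by \<open>0\<close>.

  Formally, this is an induction on the remaining time (\<open>expected_nth_pull_antimono\<close>). Its case
  of a pull made right away needs the bound \<open>expected_first_pull_le\<close>: starting in state \<open>s\<close>, the
  first pull is expected to bring at most the reward of pulling in \<open>s\<close>.\<close>


section \<open>The reward of a single pull along a trajectory\<close>

text \<open>Pulls are counted from \<open>0\<close>; the value is \<open>0\<close> if the trajectory has too few of them.\<close>

primrec nth_pull_reward :: "('s \<Rightarrow> 'a \<Rightarrow> real) \<Rightarrow> 'a \<Rightarrow> ('s \<times> 'a) list \<Rightarrow> nat \<Rightarrow> real" where
  "nth_pull_reward r \<phi> [] j = 0"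
| "nth_pull_reward r \<phi> (y # w) j =
     (if snd y = \<phi> then nth_pull_reward r \<phi> w j
      else case j of 0 \<Rightarrow> r (fst y) (snd y) | Suc j' \<Rightarrow> nth_pull_reward r \<phi> w j')"

text \<open>Truncating after \<open>m\<close> pulls leaves the rewards of the pulls \<open>0, \<dots>, m - 1\<close>. The truncated
  sum also contains the idle steps before the next pull, which is why these must be worth \<open>0\<close>.\<close>

lemma truncated_reward_eq_sum_nth_pull_reward:
  assumes "\<forall>y\<in>set w. snd y = \<phi> \<longrightarrow> r (fst y) \<phi> = 0"
  shows "(\<Sum>l<length w. of_bool ((\<Sum>t=0..l. of_bool (snd (w ! t) \<noteq> \<phi>)) \<le> (m::nat))
            * r (fst (w ! l)) (snd (w ! l)))
         = (\<Sum>j<m. nth_pull_reward r \<phi> w j)"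
  using assms
proof (induction w arbitrary: m)
  case Nil
  then show ?case by simp
next
  case (Cons y w)
  let ?N = "\<lambda>l. \<Sum>t=0..l. of_bool (snd (w ! t) \<noteq> \<phi>) :: nat"
  let ?r = "\<lambda>l. r (fst (w ! l)) (snd (w ! l))"
  have IH: "(\<Sum>l<length w. of_bool (?N l \<le> k) * ?r l) = (\<Sum>j<k. nth_pull_reward r \<phi> w j)" for k
    using Cons by auto
  have split: "(\<Sum>l<length (y # w). of_bool ((\<Sum>t=0..l. of_bool (snd ((y # w) ! t) \<noteq> \<phi>)) \<le> m)
            * r (fst ((y # w) ! l)) (snd ((y # w) ! l)))
     = of_bool (of_bool (snd y \<noteq> \<phi>) \<le> m) * r (fst y) (snd y)
       + (\<Sum>l<length w. of_bool (of_bool (snd y \<noteq> \<phi>) + ?N l \<le> m) * ?r l)"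
    by (simp add: sum.lessThan_Suc_shift sum.atLeast0_atMost_Suc_shift
        del: sum.lessThan_Suc sum.cl_ivl_Suc sum_of_bool_eq sum_of_bool_mult_eq sum_mult_of_bool_eq)
  show ?case
  proof (cases "snd y = \<phi>")
    case True
    then show ?thesis using Cons.prems split IH[of m] by simp
  next
    case False
    show ?thesis
    proof (cases m)
      case 0
      then show ?thesis using False split by simp
    next
      case (Suc k)
      then show ?thesis using False split IH[of k]
        by (simp add: sum.lessThan_Suc_shift del: sum.lessThan_Suc)
    qed
  qed
qed


section \<open>A single arm whose pull reward decreases on average\<close>

locale coin_arm =
  fixes B :: "('s, 'a) bandit"
    and \<mu> :: "nat \<Rightarrow> 's \<Rightarrow> nat \<Rightarrow> 'a pmf"
    and i :: nat
    and p :: 'a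
  assumes finite_sts: "finite (sts B i)"
    and acts_eq: "acts B i = {p, idle B i}"
    and rew_nonneg: "\<And>s a. s \<in> sts B i \<Longrightarrow> a \<in> acts B i \<Longrightarrow> 0 \<le> rew B i s a"
    and kern_sts: "\<And>s a. s \<in> sts B i \<Longrightarrow> a \<in> acts B i \<Longrightarrow> set_pmf (kern B i s a) \<subseteq> sts B i"
    and rew_idle: "\<And>s. s \<in> sts B i \<Longrightarrow> rew B i s (idle B i) = 0"
    and kern_idle: "\<And>s. s \<in> sts B i \<Longrightarrow> pmf (kern B i s (idle B i)) s = 1"
    and policy_acts:
      "\<And>s t. s \<in> sts B i \<Longrightarrow> t < horizon B \<Longrightarrow> set_pmf (\<mu> i s t) \<subseteq> acts B i"
    and pull_supermean: "\<And>s. s \<in> sts B i \<Longrightarrow>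
      (\<Sum>s'\<in>sts B i. pmf (kern B i s p) s' * rew B i s' p) \<le> rew B i s p"
begin

abbreviation expected_nth_pull :: "nat \<Rightarrow> nat \<Rightarrow> 's \<Rightarrow> nat \<Rightarrow> real" where
  "expected_nth_pull d t s j \<equiv> measure_pmf.expectation (arm_run B \<mu> i d t s)
     (\<lambda>w. nth_pull_reward (rew B i) (idle B i) w j)"

abbreviation expected_nth_pull_after :: "nat \<Rightarrow> nat \<Rightarrow> 's \<Rightarrow> 'a \<Rightarrow> nat \<Rightarrow> real" where
  "expected_nth_pull_after d t s a j \<equiv> \<Sum>s'\<in>sts B i. pmf (kern B i s a) s' *
     measure_pmf.expectation (arm_run B \<mu> i d (Suc t) s')
       (\<lambda>w. nth_pull_reward (rew B i) (idle B i) ((s, a) # w) j)"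

lemma finite_acts: "finite (acts B i)"
  by (simp add: acts_eq)

lemma set_arm_run:
  assumes "s \<in> sts B i" "t + d \<le> horizon B"
  shows "set_pmf (arm_run B \<mu> i d t s) \<subseteq> {w. set w \<subseteq> sts B i \<times> acts B i \<and> length w = d}"
  using assms
proof (induction d arbitrary: t s)
  case 0
  then show ?case by simp
next
  case (Suc d)
  show ?case
  proof
    fix v assume "v \<in> set_pmf (arm_run B \<mu> i (Suc d) t s)"
    then obtain a s' w where v: "a \<in> set_pmf (\<mu> i s t)" "s' \<in> set_pmf (kern B i s a)"
        "w \<in> set_pmf (arm_run B \<mu> i d (Suc t) s')" "v = (s, a) # w"
      by auto
    have a: "a \<in> acts B i" using policy_acts[of s t] Suc.prems v(1) by auto
    then have "s' \<in> sts B i" using kern_sts[of s a] Suc.prems(1) v(2) by blast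
    then have "set w \<subseteq> sts B i \<times> acts B i \<and> length w = d"
      using Suc.IH[of s' "Suc t"] Suc.prems(2) v(3) by auto
    then show "v \<in> {w. set w \<subseteq> sts B i \<times> acts B i \<and> length w = Suc d}"
      using v(4) a Suc.prems(1) by simp
  qed
qed

lemma finite_set_arm_run:
  assumes "s \<in> sts B i" "t + d \<le> horizon B"
  shows "finite (set_pmf (arm_run B \<mu> i d t s))"
  using finite_subset[OF set_arm_run[OF assms]] finite_sts finite_acts
  by (simp add: finite_lists_length_eq)

lemma sum_kern_eq_1:
  assumes "s \<in> sts B i" "a \<in> acts B i"
  shows "(\<Sum>s'\<in>sts B i. pmf (kern B i s a) s') = 1"
  using finite_sts kern_sts[OF assms] by (rule sum_pmf_eq_1)

lemma sum_policy_eq_1: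
  assumes "s \<in> sts B i" "t < horizon B"
  shows "(\<Sum>a\<in>acts B i. pmf (\<mu> i s t) a) = 1"
  using finite_acts policy_acts[OF assms] by (rule sum_pmf_eq_1)

lemma expected_nth_pull_Suc:
  assumes s: "s \<in> sts B i" and t: "t + Suc d \<le> horizon B"
  shows "expected_nth_pull (Suc d) t s j
    = (\<Sum>a\<in>acts B i. pmf (\<mu> i s t) a * expected_nth_pull_after d t s a j)"
proof -
  let ?h = "\<lambda>w. nth_pull_reward (rew B i) (idle B i) w j"
  let ?tail = "\<lambda>a s'. map_pmf (\<lambda>w. (s, a) # w) (arm_run B \<mu> i d (Suc t) s')"
  have fin_tail: "finite (set_pmf (?tail a s'))" if "s' \<in> sts B i" for a s'
    using finite_set_arm_run[OF that, of "Suc t" d] t by simp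
  have fin_kern: "finite (set_pmf (bind_pmf (kern B i s a) (?tail a)))" if "a \<in> acts B i" for a
  proof -
    have K: "set_pmf (kern B i s a) \<subseteq> sts B i" by (rule kern_sts[OF s that])
    then have "finite (set_pmf (kern B i s a))" using finite_sts by (rule finite_subset)
    then show ?thesis
      unfolding set_bind_pmf using K fin_tail by blast
  qed
  have after: "measure_pmf.expectation (bind_pmf (kern B i s a) (?tail a)) ?h
      = expected_nth_pull_after d t s a j" if "a \<in> acts B i" for a
    using fin_tail kern_sts[OF s that] finite_sts
    by (subst pmf_expectation_bind[where A = "sts B i"]) auto
  have "expected_nth_pull (Suc d) t s j
      = (\<Sum>a\<in>acts B i. pmf (\<mu> i s t) a *
          measure_pmf.expectation (bind_pmf (kern B i s a) (?tail a)) ?h)"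
    using fin_kern policy_acts[OF s, of t] t finite_acts unfolding arm_run.simps
    by (subst pmf_expectation_bind[where A = "acts B i"]) auto
  also have "\<dots> = (\<Sum>a\<in>acts B i. pmf (\<mu> i s t) a * expected_nth_pull_after d t s a j)"
    using after by (intro sum.cong) auto
  finally show ?thesis .
qed

text \<open>Resting changes neither the state nor the number of pulls, and only uses up time.\<close>

lemma expected_nth_pull_after_idle:
  assumes "s \<in> sts B i"
  shows "expected_nth_pull_after d t s (idle B i) j = expected_nth_pull d (Suc t) s j"
proof -
  have "kern B i s (idle B i) = return_pmf s"
    using kern_idle[OF assms]
    by (simp add: pmf.rep_eq measure_pmf.prob_eq_1 AE_measure_pmf_iff subset_iff
        flip: set_pmf_subset_singleton)
  then show ?thesis
    using assms finite_sts
    by (simp add: indicator_def sum.delta' if_distrib[of "\<lambda>u. u * _"] cong: if_cong)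
qed

lemma expected_nth_pull_after_pull_0:
  assumes "s \<in> sts B i" "a \<in> acts B i" "a \<noteq> idle B i"
  shows "expected_nth_pull_after d t s a 0 = rew B i s a"
  using assms sum_kern_eq_1[OF assms(1,2)] by (simp flip: sum_distrib_right)

lemma expected_nth_pull_after_pull_Suc:
  assumes "a \<noteq> idle B i"
  shows "expected_nth_pull_after d t s a (Suc j)
    = (\<Sum>s'\<in>sts B i. pmf (kern B i s a) s' * expected_nth_pull d (Suc t) s' j)"
  using assms by simp

text \<open>The arm is still in state \<open>s\<close> when it is pulled for the first time, so that pull earns
  \<open>rew B i s p\<close> or, if time runs out, \<open>0\<close>.\<close>

lemma expected_first_pull_le:
  assumes "s \<in> sts B i" "t + d \<le> horizon B"
  shows "expected_nth_pull d t s 0 \<le> rew B i s p"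
  using assms
proof (induction d arbitrary: t)
  case 0
  then show ?case using rew_nonneg[of s p] by (simp add: acts_eq)
next
  case (Suc d)
  note s = Suc.prems(1)
  have after: "expected_nth_pull_after d t s a 0 \<le> rew B i s p" if a: "a \<in> acts B i" for a
  proof (cases "a = idle B i")
    case True
    then show ?thesis
      using expected_nth_pull_after_idle[OF s] Suc.IH[OF s, of "Suc t"] Suc.prems(2) by simp
  next
    case False
    then show ?thesis
      using expected_nth_pull_after_pull_0[OF s a False] a by (simp add: acts_eq)
  qed
  have "expected_nth_pull (Suc d) t s 0
      = (\<Sum>a\<in>acts B i. pmf (\<mu> i s t) a * expected_nth_pull_after d t s a 0)"
    by (rule expected_nth_pull_Suc[OF Suc.prems])
  also have "\<dots> \<le> (\<Sum>a\<in>acts B i. pmf (\<mu> i s t) a * rew B i s p)"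
    by (intro sum_mono mult_left_mono after pmf_nonneg)
  also have "\<dots> = rew B i s p"
    using sum_policy_eq_1[OF s, of t] Suc.prems(2) by (simp flip: sum_distrib_right)
  finally show ?case .
qed

text \<open>The comparison holds for either first action. After resting, it is the induction
  hypothesis in the same state. After pulling, pulls \<open>j\<close> and \<open>j + 1\<close> become pulls \<open>j - 1\<close> and \<open>j\<close>
  of the remaining run, so the induction hypothesis applies again unless \<open>j = 0\<close>; in that case
  the next pull happens in the successor state, and the reward there is bounded on average by
  the reward just earned.\<close>

lemma expected_nth_pull_antimono:
  assumes "s \<in> sts B i" "t + d \<le> horizon B"
  shows "expected_nth_pull d t s (Suc j) \<le> expected_nth_pull d t s j"
  using assms
proof (induction d arbitrary: t s j)
  case 0
  then show ?case by simp
next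
  case (Suc d)
  note s = Suc.prems(1)
  have t: "Suc t + d \<le> horizon B" using Suc.prems(2) by simp
  have after: "expected_nth_pull_after d t s a (Suc j) \<le> expected_nth_pull_after d t s a j"
    if a: "a \<in> acts B i" for a
  proof (cases "a = idle B i")
    case True
    show ?thesis
      unfolding True expected_nth_pull_after_idle[OF s] by (rule Suc.IH[OF s t])
  next
    case False
    then have "a = p" using a by (simp add: acts_eq)
    show ?thesis
    proof (cases j)
      case 0
      have "expected_nth_pull_after d t s a (Suc 0)
          \<le> (\<Sum>s'\<in>sts B i. pmf (kern B i s a) s' * rew B i s' p)"
        unfolding expected_nth_pull_after_pull_Suc[OF False]
        by (intro sum_mono mult_left_mono pmf_nonneg expected_first_pull_le t)
      also have "\<dots> \<le> rew B i s a"
        using pull_supermean[OF s] \<open>a = p\<close> by simp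
      also have "\<dots> = expected_nth_pull_after d t s a 0"
        by (rule expected_nth_pull_after_pull_0[OF s a False, symmetric])
      finally show ?thesis unfolding 0 .
    next
      case (Suc k)
      show ?thesis
        unfolding Suc expected_nth_pull_after_pull_Suc[OF False]
        by (intro sum_mono mult_left_mono pmf_nonneg Suc.IH t)
    qed
  qed
  show ?case
    unfolding expected_nth_pull_Suc[OF Suc.prems]
    by (intro sum_mono mult_left_mono pmf_nonneg after)
qed

text \<open>The reward depends on the trajectory of arm \<open>i\<close> only, whose law is a marginal of the
  product law of all arms. Within its support, idle entries carry no reward, so truncated
  rewards split into pulls.\<close>

lemma expected_pull_reward_eq_sum:
  assumes i: "i \<in> arms B" and s: "s\<^sub>0 i \<in> sts B i"
  shows "expected_pull_reward B \<mu> s\<^sub>0 i m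
    = (\<Sum>j<m. expected_nth_pull (horizon B) 0 (s\<^sub>0 i) j)"
proof -
  define M where "M = arm_run B \<mu> i (horizon B) 0 (s\<^sub>0 i)"
  define F where "F w = (\<Sum>l<horizon B. of_bool ((\<Sum>t=0..l. of_bool (snd (w ! t) \<noteq> idle B i)) \<le> m)
      * rew B i (fst (w ! l)) (snd (w ! l)))" for w :: "('s \<times> 'a) list"
  have M_set: "set_pmf M \<subseteq> {w. set w \<subseteq> sts B i \<times> acts B i \<and> length w = horizon B}"
    unfolding M_def by (rule set_arm_run) (simp_all add: s)
  have fin: "finite (set_pmf M)"
    unfolding M_def by (rule finite_set_arm_run) (simp_all add: s)
  have "M = map_pmf (\<lambda>\<omega>. \<omega> i) (run_law B \<mu> s\<^sub>0)"
    unfolding M_def run_law_def using i by (subst Pi_pmf_component) auto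
  then have "expected_pull_reward B \<mu> s\<^sub>0 i m = measure_pmf.expectation M F"
    by (simp add: expected_pull_reward_def pull_reward_def[abs_def] pulls_def F_def)
  also have "\<dots> = measure_pmf.expectation M
      (\<lambda>w. \<Sum>j<m. nth_pull_reward (rew B i) (idle B i) w j)"
  proof (rule integral_cong_AE)
    have "F w = (\<Sum>j<m. nth_pull_reward (rew B i) (idle B i) w j)" if "w \<in> set_pmf M" for w
    proof -
      have w: "set w \<subseteq> sts B i \<times> acts B i" "length w = horizon B" using M_set that by auto
      then have "\<forall>y\<in>set w. snd y = idle B i \<longrightarrow> rew B i (fst y) (idle B i) = 0"
        using rew_idle by auto
      from truncated_reward_eq_sum_nth_pull_reward[where r = "rew B i", OF this, of m]
      show ?thesis unfolding F_def w(2) .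
    qed
    then show "AE w in M. F w = (\<Sum>j<m. nth_pull_reward (rew B i) (idle B i) w j)"
      by (simp add: AE_measure_pmf_iff)
  qed simp_all
  also have "\<dots> = (\<Sum>j<m. measure_pmf.expectation M
      (\<lambda>w. nth_pull_reward (rew B i) (idle B i) w j))"
    by (intro Bochner_Integration.integral_sum integrable_measure_pmf_finite fin)
  finally show ?thesis unfolding M_def .
qed

end


section \<open>Decreasing returns\<close>

theorem lemma2:
  fixes B :: "('s, 'a) bandit"
    and p :: 'a
    and s\<^sub>0 :: "nat \<Rightarrow> 's"
    and x :: "('s, 'a) rlp_point"
    and \<mu> :: "nat \<Rightarrow> 's \<Rightarrow> nat \<Rightarrow> 'a pmf"
  assumes "bandit_model B"
    and "s\<^sub>0 \<in> joint_sts B"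
    and "rlp_optimal B (return_pmf s\<^sub>0) x"
    and "relaxed_policy B x \<mu>"
    and "\<forall>i\<in>arms B. acts B i = {p, idle B i}"
    and "\<forall>i\<in>arms B. \<forall>s\<in>sts B i.
           rew B i s p \<ge> (\<Sum>s'\<in>sts B i. pmf (kern B i s p) s' * rew B i s' p)"
  shows "decreasing_returns B \<mu> s\<^sub>0"
  unfolding decreasing_returns_def
proof (intro ballI allI impI)
  fix i m
  assume i: "i \<in> arms B" and m: "0 < m \<and> m < horizon B"
  have arm: "finite (sts B i)" "s \<in> sts B i \<Longrightarrow> rew B i s (idle B i) = 0"
      "s \<in> sts B i \<Longrightarrow> pmf (kern B i s (idle B i)) s = 1"
      "s \<in> sts B i \<Longrightarrow> a \<in> acts B i \<Longrightarrow> 0 \<le> rew B i s a"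
      "s \<in> sts B i \<Longrightarrow> a \<in> acts B i \<Longrightarrow> set_pmf (kern B i s a) \<subseteq> sts B i" for s a
    using assms(1) i unfolding bandit_model_def by blast+
  have policy: "set_pmf (\<mu> i s t) \<subseteq> acts B i" if "s \<in> sts B i" "t < horizon B" for s t
    using assms(4) i that unfolding relaxed_policy_def by blast
  have acts: "acts B i = {p, idle B i}"
    using assms(5) i by blast
  have supermean: "(\<Sum>s'\<in>sts B i. pmf (kern B i s p) s' * rew B i s' p) \<le> rew B i s p"
    if "s \<in> sts B i" for s
    using assms(6) i that by blast
  interpret coin_arm B \<mu> i p
    by (rule coin_arm.intro; fact arm acts policy supermean)
  have s: "s\<^sub>0 i \<in> sts B i"
    using assms(2) i by (auto simp: joint_sts_def PiE_def)
  obtain k where k: "m = Suc k" using m by (cases m) auto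
  show "expected_pull_reward B \<mu> s\<^sub>0 i (m + 1) - expected_pull_reward B \<mu> s\<^sub>0 i m
      \<le> expected_pull_reward B \<mu> s\<^sub>0 i m - expected_pull_reward B \<mu> s\<^sub>0 i (m - 1)"
    using expected_nth_pull_antimono[OF s, of 0 "horizon B" k]
    by (simp add: k expected_pull_reward_eq_sum[where s\<^sub>0 = s\<^sub>0, OF i s])
qed

end
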